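(* Consider the non-degenerate action of $SE(2)$ on $\mathcal K_0^2(\mathbb E^2)\times\mathcal K_0^2(\mathbb E^2)$, with parameters $(\alpha_1,\dots,\alpha_6)$ on one copy of $\mathcal K_0^2(\mathbb E^2)$ and $(\beta_1,\dots,\beta_6)$ on the other. Let $F_1,F_2$ be the foci determined by the $\beta_j$, and $F_3,F_4$ the foci determined by the $\alpha_j$, with $F_i=(x_i,y_i)$. Set $$\begin{aligned} \Delta'_1&=\alpha_6,\\ \Delta'_2&=\alpha_6(\alpha_1+\alpha_2)-\alpha_4^2-\alpha_5^2,\\ \Delta'_3&=(\alpha_6(\alpha_1-\alpha_2)-\alpha_4^2+\alpha_5^2)^2+4(\alpha_6\alpha_3+\alpha_4\alpha_5)^2,\\ \Delta'_4&=\beta_6,\\ \Delta'_5&=\beta_6(\beta_1+\beta_2)-\beta_4^2-\beta_5^2,\\ \Delta'_6&=(\beta_6(\beta_1-\beta_2)-\beta_4^2+\beta_5^2)^2+4(\beta_6\beta_3+\beta_4\beta_5)^2,\\ \Delta'_7&=d^2(F_2,F_3)=(x_2-x_3)^2+(y_2-y_3)^2,\\ \Delta'_8&=d^2(F_1,F_3)=(x_1-x_3)^2+(y_1-y_3)^2,\\ \Delta'_9&=d^2(F_2,F_4)=(x_2-x_4)^2+(y_2-y_4)^2. \end{aligned}$$ Then every joint invariant of the non-degenerate action of $SE(2)$ on $\mathcal K_0^2(\mathbb E^2)\times\mathcal K_0^2(\mathbb E^2)$ is a function of the nine fundamental joint invariants $\Delta'_i(\alpha_j,\beta_j)$, $i=1,\dots,9$,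 $j=1,\dots,6$.
   Context: $\mathcal K_0^2(\mathbb E^2)$ is the 6-dimensional real vector space of symmetric contravariant Killing two-tensors of the Euclidean plane. In Cartesian coordinates $(x_1,x_2)$ of the plane its general element $\mathbf K$ has components $$K^{11}=\beta_1+2\beta_4x_2+\beta_6x_2^2,\quad K^{12}=\beta_3-\beta_4x_1-\beta_5x_2-\beta_6x_1x_2,\quad K^{22}=\beta_2+2\beta_5x_1+\beta_6x_1^2,$$ where $\beta_1,\dots,\beta_6\in\mathbb R$ are the parameters of $\mathbf K$. $SE(2)$ is the group of orientation-preserving isometries of $\mathbb E^2$, $(x,y)\mapsto(x\cos p_3-y\sin p_3+p_1,\ x\sin p_3+y\cos p_3+p_2)$. It acts on $\mathcal K_0^2(\mathbb E^2)$ by the induced transformation of the parameters: $$\begin{aligned} \tilde\beta_1&=\beta_1\cos^2p_3-2\beta_3\cos p_3\sin p_3+\beta_2\sin^2p_3-2p_2\beta_4\cos p_3-2p_2\beta_5\sin p_3+\beta_6p_2^2,\\ \tilde\beta_2&=\beta_1\sin^2p_3+2\beta_3\cos p_3\sin p_3+\beta_2\cos^2p_3-2p_1\beta_5\cos p_3+2p_1\beta_4\sin p_3+\beta_6p_1^2,\\ \tilde\beta_3&=(\beta_1-\beta_2)\sin p_3\cos p_3+\beta_3(\cos^2p_3-\sin^2p_3)+(p_1\beta_4+p_2\beta_5)\cos p_3+(p_1\beta_5-p_2\beta_4)\sin p_3-\beta_6p_1p_2,\\ \tilde\beta_4&=\beta_4\cos p_3+\beta_5\sin p_3-\beta_6p_2,\\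 \tilde\beta_5&=\beta_5\cos p_3-\beta_4\sin p_3-\beta_6p_1,\\ \tilde\beta_6&=\beta_6. \end{aligned}$$ The action on the product of two copies is the simultaneous one: the same formulas, with the same $p_1,p_2,p_3$, are applied to the $\alpha_j$ and to the $\beta_j$. A joint invariant is a function of $(\alpha_j,\beta_j)$ that is unchanged by this action. Non-degenerate: a three-dimensional $SE(2)$-orbit in $\mathcal K_0^2(\mathbb E^2)$ is non-degenerate if along it the invariant $k^2=\sqrt{\Delta}/\beta_6^2$ is non-zero, where $\Delta=(\beta_6(\beta_1-\beta_2)-\beta_4^2+\beta_5^2)^2+4(\beta_6\beta_3+\beta_4\beta_5)^2$. The action on the product is non-degenerate when this holds for both copies, i.e. $k_1^2=\sqrt{\Delta'_3}/\alpha_6^2\ne0$ and $k_2^2=\sqrt{\Delta'_6}/\beta_6^2\neq0$. The eigenvectors of a Killing tensor in a non-degenerate orbit generate an elliptic-hyperbolic coordinate web (two families of confocal ellipses and hyperbolas), which has two foci. Foci: with $\sigma_1=\beta_4^2-\beta_5^2+\beta_6(\beta_2-\beta_1)$ and $\sigma_2=\alpha_4^2-\alpha_5^2+\alpha_6(\alpha_2-\alpha_1)$, the coordinates of the foci are given as $$(x_1,y_1)=\left(\frac{-\beta_5}{\beta_6}+\frac1{\beta_6}\left(\frac{\sqrt{\Delta'_6}-\sigma_1}{2}\right)^{1/2},\ \frac{-\beta_4}{\beta_6}+\frac1{\beta_6}\left(\frac{\sqrt{\Delta'_6}+\sigma_1}{2}\right)^{1/2}\right),$$ $$(x_2,y_2)=\left(\frac{-\beta_5}{\beta_6}-\frac1{\beta_6}\left(\frac{\sqrt{\Delta'_6}-\sigma_1}{2}\right)^{1/2},\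 \frac{-\beta_4}{\beta_6}-\frac1{\beta_6}\left(\frac{\sqrt{\Delta'_6}+\sigma_1}{2}\right)^{1/2}\right),$$ $$(x_3,y_3)=\left(\frac{-\alpha_5}{\alpha_6}+\frac1{\alpha_6}\left(\frac{\sqrt{\Delta'_3}-\sigma_2}{2}\right)^{1/2},\ \frac{-\alpha_4}{\alpha_6}+\frac1{\alpha_6}\left(\frac{\sqrt{\Delta'_3}+\sigma_2}{2}\right)^{1/2}\right),$$ $$(x_4,y_4)=\left(\frac{-\alpha_5}{\alpha_6}-\frac1{\alpha_6}\left(\frac{\sqrt{\Delta'_3}-\sigma_2}{2}\right)^{1/2},\ \frac{-\alpha_4}{\alpha_6}-\frac1{\alpha_6}\left(\frac{\sqrt{\Delta'_3}+\sigma_2}{2}\right)^{1/2}\right).$$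
   Formalization: One global function fails: reflection keeps all nine values but flips a joint invariant. Proved locally, near pairs where neither F1,F2,F3 nor F2,F3,F4 are collinear (a dense set), with arbitrarily labelled foci whose half-power signs satisfy uv = β6β3+β4β5 (likewise for α). *)

theory Defs
  imports "HOL-Analysis.Analysis"
begin

type_synonym plane = "real \<times> real"

text \<open>A Killing two-tensor of the plane is given by its parameters
  \<open>(\<beta>\<^sub>1, \<dots>, \<beta>\<^sub>6)\<close>; \<open>killing_comps\<close> lists the components
  \<open>(K\<^sup>1\<^sup>1, K\<^sup>1\<^sup>2, K\<^sup>2\<^sup>2)\<close> at a point.\<close>

type_synonym killing = "real \<times> real \<times> real \<times> real \<times> real \<times> real"

fun killing_comps :: "killing \<Rightarrow> plane \<Rightarrow> real \<times> real \<times> real" where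
  "killing_comps (b1, b2, b3, b4, b5, b6) (x1, x2) =
     (b1 + 2 * b4 * x2 + b6 * x2\<^sup>2,
      b3 - b4 * x1 - b5 * x2 - b6 * x1 * x2,
      b2 + 2 * b5 * x1 + b6 * x1\<^sup>2)"

text \<open>Elements of \<open>SE(2)\<close> are written through parameters \<open>(p\<^sub>1, p\<^sub>2, p\<^sub>3)\<close>, the angle
  \<open>p\<^sub>3\<close> ranging over all reals.\<close>

type_synonym se2 = "real \<times> real \<times> real"

fun move :: "se2 \<Rightarrow> plane \<Rightarrow> plane" where
  "move (p1, p2, p3) (x, y) =
     (x * cos p3 - y * sin p3 + p1, x * sin p3 + y * cos p3 + p2)"

fun act :: "se2 \<Rightarrow> killing \<Rightarrow> killing" where
  "act (p1, p2, p3) (b1, b2, b3, b4, b5, b6) =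
     (b1 * (cos p3)\<^sup>2 - 2 * b3 * cos p3 * sin p3 + b2 * (sin p3)\<^sup>2
        - 2 * p2 * b4 * cos p3 - 2 * p2 * b5 * sin p3 + b6 * p2\<^sup>2,
      b1 * (sin p3)\<^sup>2 + 2 * b3 * cos p3 * sin p3 + b2 * (cos p3)\<^sup>2
        - 2 * p1 * b5 * cos p3 + 2 * p1 * b4 * sin p3 + b6 * p1\<^sup>2,
      (b1 - b2) * sin p3 * cos p3 + b3 * ((cos p3)\<^sup>2 - (sin p3)\<^sup>2)
        + (p1 * b4 + p2 * b5) * cos p3 + (p1 * b5 - p2 * b4) * sin p3 - b6 * p1 * p2,
      b4 * cos p3 + b5 * sin p3 - b6 * p2,
      b5 * cos p3 - b4 * sin p3 - b6 * p1,
      b6)"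

fun inv_lead :: "killing \<Rightarrow> real" where
  "inv_lead (b1, b2, b3, b4, b5, b6) = b6"

fun inv_trace :: "killing \<Rightarrow> real" where
  "inv_trace (b1, b2, b3, b4, b5, b6) = b6 * (b1 + b2) - b4\<^sup>2 - b5\<^sup>2"

fun inv_Delta :: "killing \<Rightarrow> real" where
  "inv_Delta (b1, b2, b3, b4, b5, b6) =
     (b6 * (b1 - b2) - b4\<^sup>2 + b5\<^sup>2)\<^sup>2 + 4 * (b6 * b3 + b4 * b5)\<^sup>2"

fun sigma :: "killing \<Rightarrow> real" where
  "sigma (b1, b2, b3, b4, b5, b6) = b4\<^sup>2 - b5\<^sup>2 + b6 * (b2 - b1)"

definition k_squared :: "killing \<Rightarrow> real" where
  "k_squared b = sqrt (inv_Delta b) / (inv_lead b)\<^sup>2"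

text \<open>\<open>k\<^sup>2\<close> is only defined where \<open>\<beta>\<^sub>6 \<noteq> 0\<close>.\<close>

definition nondegenerate :: "killing \<Rightarrow> bool" where
  "nondegenerate b \<longleftrightarrow> inv_lead b \<noteq> 0 \<and> k_squared b \<noteq> 0"

definition joint_invariant :: "(killing \<times> killing \<Rightarrow> real) \<Rightarrow> bool" where
  "joint_invariant I \<longleftrightarrow>
     (\<forall>p a b. nondegenerate a \<longrightarrow> nondegenerate b \<longrightarrow> I (act p a, act p b) = I (a, b))"

text \<open>\<open>foci b P Q\<close>: the ordered pair \<open>(P, Q)\<close> is a labelling of the two foci of \<open>b\<close>.
  The half powers \<open>((\<surd>\<Delta> - \<sigma>)/2)\<^sup>1\<^sup>/\<^sup>2\<close> and \<open>((\<surd>\<Delta> + \<sigma>)/2)\<^sup>1\<^sup>/\<^sup>2\<close> in the focus formulas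
  are square roots \<open>u\<close>, \<open>v\<close> whose signs must be compatible with the tensor:
  \<open>u v = \<beta>\<^sub>6 \<beta>\<^sub>3 + \<beta>\<^sub>4 \<beta>\<^sub>5\<close>. (If this number is negative, two nonnegative roots give the foci
  of another web, namely the mirror image in a coordinate direction.) The remaining
  freedom \<open>(u, v) \<mapsto> (-u, -v)\<close> exchanges the labels of the foci.\<close>

fun foci :: "killing \<Rightarrow> plane \<Rightarrow> plane \<Rightarrow> bool" where
  "foci (b1, b2, b3, b4, b5, b6) P Q \<longleftrightarrow>
     (let D = inv_Delta (b1, b2, b3, b4, b5, b6); s = sigma (b1, b2, b3, b4, b5, b6) in
      \<exists>u v. u\<^sup>2 = (sqrt D - s) / 2 \<and> v\<^sup>2 = (sqrt D + s) / 2 \<and> u * v = b6 * b3 + b4 * b5 \<and>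
        P = (- b5 / b6 + 1 / b6 * u, - b4 / b6 + 1 / b6 * v) \<and>
        Q = (- b5 / b6 - 1 / b6 * u, - b4 / b6 - 1 / b6 * v))"

text \<open>The foci in this sense exist; for a non-degenerate tensor they are distinct and are exactly the singular points of the
  web, i.e. the points at which the two eigenvalues of the Killing tensor coincide.\<close>

lemma foci_exist: "\<exists>P Q. foci b P Q"
proof -
  obtain b1 b2 b3 b4 b5 b6 where b: "b = (b1, b2, b3, b4, b5, b6)"
    by (cases b) auto
  define D where "D = inv_Delta b"
  define s where "s = sigma b"
  define C where "C = b6 * b3 + b4 * b5"
  have D: "D = s\<^sup>2 + (2 * C)\<^sup>2"
    by (simp add: D_def s_def C_def b power2_eq_square algebra_simps)
  have "\<bar>s\<bar> \<le> sqrt D"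
    unfolding D by (rule real_le_rsqrt) simp
  then have nn: "(sqrt D - s) / 2 \<ge> 0" "(sqrt D + s) / 2 \<ge> 0"
    by auto
  define u where "u = sqrt ((sqrt D - s) / 2)"
  define w where "w = sqrt ((sqrt D + s) / 2)"
  define v where "v = (if C \<ge> 0 then w else - w)"
  have uu: "u\<^sup>2 = (sqrt D - s) / 2" and ww: "w\<^sup>2 = (sqrt D + s) / 2"
    using nn by (simp_all add: u_def w_def)
  have "(sqrt D)\<^sup>2 = D"
    unfolding D by simp
  then have "(u * w)\<^sup>2 = C\<^sup>2"
    unfolding power_mult_distrib uu ww using D
    by (simp add: power2_eq_square field_simps)
  moreover have "u * w \<ge> 0"
    using nn by (simp add: u_def w_def)
  ultimately have "u * w = \<bar>C\<bar>"
    by (smt (verit) power2_eq_iff)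
  then have "u * v = C"
    by (auto simp: v_def)
  moreover have "v\<^sup>2 = (sqrt D + s) / 2"
    using ww by (simp add: v_def)
  ultimately show ?thesis
    using uu unfolding b foci.simps Let_def D_def s_def C_def by blast
qed

lemma foci_singular_points:
  assumes "nondegenerate b" "foci b P Q"
  shows "P \<noteq> Q \<and> {x. \<exists>l. killing_comps b x = (l, 0, l)} = {P, Q}"
proof -
  obtain b1 b2 b3 b4 b5 b6 where b: "b = (b1, b2, b3, b4, b5, b6)"
    by (cases b) auto
  define D where "D = inv_Delta b"
  define s where "s = sigma b"
  have s: "s = b4\<^sup>2 - b5\<^sup>2 + b6 * (b2 - b1)"
    by (simp add: s_def b)
  from assms(2) obtain u v where
    uu: "u\<^sup>2 = (sqrt D - s) / 2" and vv: "v\<^sup>2 = (sqrt D + s) / 2"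
    and uv: "u * v = b6 * b3 + b4 * b5"
    and P: "P = (- b5 / b6 + 1 / b6 * u, - b4 / b6 + 1 / b6 * v)"
    and Q: "Q = (- b5 / b6 - 1 / b6 * u, - b4 / b6 - 1 / b6 * v)"
    unfolding b foci.simps Let_def D_def s_def by blast
  have b6: "b6 \<noteq> 0" and D0: "sqrt D \<noteq> 0"
    using assms(1) by (auto simp: nondegenerate_def k_squared_def b D_def)
  have sum: "u\<^sup>2 + v\<^sup>2 = sqrt D" and diff: "v\<^sup>2 - u\<^sup>2 = s"
    unfolding uu vv by (simp_all add: field_simps)
  have ne: "u \<noteq> 0 \<or> v \<noteq> 0"
    using sum D0 by auto
  have sing: "(\<exists>l. killing_comps b (x1, x2) = (l, 0, l)) \<longleftrightarrow>
      (b6 * x1 + b5 = u \<and> b6 * x2 + b4 = v) \<or> (b6 * x1 + b5 = - u \<and> b6 * x2 + b4 = - v)"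
    (is "?L \<longleftrightarrow> ?R") for x1 x2
  proof -
    define X where "X = b6 * x1 + b5"
    define Y where "Y = b6 * x2 + b4"
    define K11 where "K11 = b1 + 2 * b4 * x2 + b6 * x2\<^sup>2"
    define K12 where "K12 = b3 - b4 * x1 - b5 * x2 - b6 * x1 * x2"
    define K22 where "K22 = b2 + 2 * b5 * x1 + b6 * x1\<^sup>2"
    have 1: "b6 * K12 = u * v - X * Y"
      unfolding uv by (simp add: X_def Y_def K12_def algebra_simps)
    have 2: "b6 * (K11 - K22) = (Y\<^sup>2 - X\<^sup>2) - (v\<^sup>2 - u\<^sup>2)"
      unfolding diff s by (simp add: X_def Y_def K11_def K22_def power2_eq_square algebra_simps)
    have "?L \<longleftrightarrow> K12 = 0 \<and> K11 = K22"
      by (auto simp: b K11_def K12_def K22_def)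
    also have "\<dots> \<longleftrightarrow> b6 * K12 = 0 \<and> b6 * (K11 - K22) = 0"
      using b6 by simp
    also have "\<dots> \<longleftrightarrow> X * Y = u * v \<and> Y\<^sup>2 - X\<^sup>2 = v\<^sup>2 - u\<^sup>2"
      unfolding 1 2 by auto
    also have "\<dots> \<longleftrightarrow> (X = u \<and> Y = v) \<or> (X = - u \<and> Y = - v)"
    proof
      assume h: "X * Y = u * v \<and> Y\<^sup>2 - X\<^sup>2 = v\<^sup>2 - u\<^sup>2"
      have "Complex X Y ^ 2 = Complex u v ^ 2"
        using h by (auto simp: power2_eq_square complex_eq_iff algebra_simps)
      then have "Complex X Y = Complex u v \<or> Complex X Y = - Complex u v"
        by (simp add: power2_eq_iff)
      then show "(X = u \<and> Y = v) \<or> (X = - u \<and> Y = - v)"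
        by (auto simp: complex_eq_iff)
    qed auto
    finally show ?thesis
      by (simp add: X_def Y_def)
  qed
  have "P \<noteq> Q"
    using ne b6 by (auto simp: P Q field_simps)
  moreover have "{x. \<exists>l. killing_comps b x = (l, 0, l)} = {P, Q}"
  proof (intro set_eqI)
    fix x :: plane
    obtain x1 x2 where x: "x = (x1, x2)"
      by (cases x)
    show "x \<in> {x. \<exists>l. killing_comps b x = (l, 0, l)} \<longleftrightarrow> x \<in> {P, Q}"
      unfolding mem_Collect_eq x sing using b6 by (auto simp: P Q field_simps)
  qed
  ultimately show ?thesis
    by blast
qed

text \<open>A pair of non-degenerate Killing tensors \<open>(\<alpha>, \<beta>)\<close> with labelled foci
  \<open>F\<^sub>1, F\<^sub>2\<close> of \<open>\<beta>\<close> and \<open>F\<^sub>3, F\<^sub>4\<close> of \<open>\<alpha>\<close>. The labels are part of the data: a half turn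
  about the midpoint of \<open>F\<^sub>1, F\<^sub>2\<close> preserves \<open>\<beta>\<close> but exchanges the two foci, so no labelling
  depending on \<open>\<beta>\<close> alone is compatible with the action. The labels depend
  continuously on \<open>(\<alpha>, \<beta>)\<close> locally, and then the distances below are functions of
  \<open>(\<alpha>, \<beta>)\<close>.\<close>

type_synonym config = "killing \<times> killing \<times> plane \<times> plane \<times> plane \<times> plane"

definition configs :: "config set" where
  "configs = {(a, b, F1, F2, F3, F4).
     nondegenerate a \<and> nondegenerate b \<and> foci b F1 F2 \<and> foci a F3 F4}"

fun act_config :: "se2 \<Rightarrow> config \<Rightarrow> config" where
  "act_config p (a, b, F1, F2, F3, F4) =
     (act p a, act p b, move p F1, move p F2, move p F3, move p F4)"

fun fundamental_invariants ::
  "config \<Rightarrow> real \<times> real \<times> real \<times> real \<times> real \<times> real \<times> real \<times> real \<times> real" where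
  "fundamental_invariants (a, b, F1, F2, F3, F4) =
     (inv_lead a, inv_trace a, inv_Delta a,
      inv_lead b, inv_trace b, inv_Delta b,
      (dist F2 F3)\<^sup>2, (dist F1 F3)\<^sup>2, (dist F2 F4)\<^sup>2)"

text \<open>The configurations near which the nine invariants can separate orbits. If, say,
  \<open>F\<^sub>1, F\<^sub>2, F\<^sub>3\<close> are collinear, then the signed area of the triangle \<open>F\<^sub>1 F\<^sub>2 F\<^sub>3\<close> is locally a
  joint invariant but not a function of distances.\<close>

definition generic_configs :: "config set" where
  "generic_configs = {(a, b, F1, F2, F3, F4) \<in> configs.
     \<not> collinear {F1, F2, F3} \<and> \<not> collinear {F2, F3, F4}}"

end

theory Submission
  imports Defs
begin

text \<open>A non-degenerate Killing tensor with labelled foci is the same thing as a value of \<open>\<beta>\<^sub>6 \<noteq> 0\<close>, a value of the trace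
  invariant and an ordered pair of distinct points, its foci; the action of \<open>SE(2)\<close> is the obvious
  one in these terms, and \<open>\<Delta>\<close> gives the distance between the foci. Joint invariants of pairs of
  tensors are therefore invariants of four points in the plane. The two triangles \<open>F\<^sub>1 F\<^sub>2 F\<^sub>3\<close> and
  \<open>F\<^sub>2 F\<^sub>3 F\<^sub>4\<close> have known side lengths, so once their orientations are fixed, which is an open and
  invariant condition, the quadruple is determined up to an orientation-preserving isometry.\<close>

section \<open>Three points in the plane\<close>

text \<open>Twice the signed area of the triangle; its sign separates a triangle from its mirror
  image, which the side lengths cannot do.\<close>

fun orient :: "plane \<Rightarrow> plane \<Rightarrow> plane \<Rightarrow> real" where
  "orient (x1, y1) (x2, y2) (x3, y3) = (x2 - x1) * (y3 - y1) - (y2 - y1) * (x3 - x1)"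

lemma orient_fst_snd:
  "orient P Q R = (fst Q - fst P) * (snd R - snd P) - (snd Q - snd P) * (fst R - fst P)"
  by (cases P; cases Q; cases R) simp

lemma dist_plane_squared: "(dist (x1, y1) (x2, y2))\<^sup>2 = (x1 - x2)\<^sup>2 + (y1 - y2)\<^sup>2" for x1 :: real and y1 :: real
  by (simp add: dist_Pair_Pair dist_real_def)

lemma collinear_iff_orient: "collinear {P, Q, R} \<longleftrightarrow> orient P Q R = 0"
proof -
  obtain x1 y1 x2 y2 x3 y3 where PQR: "P = (x1, y1)" "Q = (x2, y2)" "R = (x3, y3)"
    by (cases P; cases Q; cases R)
  define a b c d where "a = x2 - x1" "b = y2 - y1" "c = x3 - x1" "d = y3 - y1"
  note defs = this
  have "collinear {P, Q, R} \<longleftrightarrow> collinear {0, Q - P, R - P}"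
    using collinear_3[of Q P R] by (simp add: insert_commute)
  also have "\<dots> \<longleftrightarrow> collinear {0, (a, b), (c, d)}"
    by (simp add: PQR defs)
  also have "\<dots> \<longleftrightarrow> a * d - b * c = 0"
    unfolding collinear_lemma
  proof
    assume "a * d - b * c = 0"
    then show "(a, b) = 0 \<or> (c, d) = 0 \<or> (\<exists>k. (c, d) = k *\<^sub>R (a, b))"
      by (cases "a = 0"; cases "b = 0")
        (auto simp: zero_prod_def field_simps intro: exI[of _ "c / a"] exI[of _ "d / b"])
  qed (auto simp: zero_prod_def algebra_simps)
  finally show ?thesis
    by (simp add: PQR defs)
qed

lemma dist_move: "dist (move p P) (move p Q) = dist P Q"
proof -
  obtain p1 p2 p3 x1 y1 x2 y2 where [simp]: "p = (p1, p2, p3)" "P = (x1, y1)" "Q = (x2, y2)"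
    by (cases p; cases P; cases Q)
  \<comment> \<open>Keeping the factor cos^2 + sin^2 makes this an identity of polynomials;
    Pythagoras enters only at the end.\<close>
  have "(dist (move p P) (move p Q))\<^sup>2 = ((cos p3)\<^sup>2 + (sin p3)\<^sup>2) * (dist P Q)\<^sup>2"
    by (simp only: \<open>p = _\<close> \<open>P = _\<close> \<open>Q = _\<close> move.simps dist_plane_squared)
      (simp only: power2_eq_square algebra_simps)
  then show ?thesis
    by (simp add: power2_eq_iff_nonneg)
qed

lemma orient_move: "orient (move p P) (move p Q) (move p R) = orient P Q R"
proof -
  obtain p1 p2 p3 x1 y1 x2 y2 x3 y3
    where eqs: "p = (p1, p2, p3)" "P = (x1, y1)" "Q = (x2, y2)" "R = (x3, y3)"
    by (cases p; cases P; cases Q; cases R)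
  have "orient (move p P) (move p Q) (move p R) = ((cos p3)\<^sup>2 + (sin p3)\<^sup>2) * orient P Q R"
    unfolding eqs move.simps orient.simps by (simp only: power2_eq_square algebra_simps)
  then show ?thesis
    by simp
qed

lemma exists_move:
  assumes "P \<noteq> Q" "dist P Q = dist P' Q'"
  shows "\<exists>p. move p P = P' \<and> move p Q = Q'"
proof -
  obtain x1 y1 x2 y2 x1' y1' x2' y2'
    where eqs: "P = (x1, y1)" "Q = (x2, y2)" "P' = (x1', y1')" "Q' = (x2', y2')"
    by (cases P; cases Q; cases P'; cases Q')
  define a b a' b' where "a = x2 - x1" "b = y2 - y1" "a' = x2' - x1'" "b' = y2' - y1'"
  note defs = this
  define n where "n = a\<^sup>2 + b\<^sup>2"
  have n0: "n \<noteq> 0"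
    using assms(1) by (auto simp: n_def defs eqs sum_power2_eq_zero_iff)
  have "(dist P Q)\<^sup>2 = (dist P' Q')\<^sup>2"
    by (simp add: assms(2))
  then have n': "a'\<^sup>2 + b'\<^sup>2 = n"
    by (simp add: n_def defs eqs dist_plane_squared power2_commute)
  \<comment> \<open>In complex notation C + i S is the quotient (a' + i b') / (a + i b), the
    rotation taking Q - P to Q' - P'; equal distances give it modulus one.\<close>
  define C where "C = (a * a' + b * b') / n"
  define S where "S = (a * b' - b * a') / n"
  have "(a * a' + b * b')\<^sup>2 + (a * b' - b * a')\<^sup>2 = (a\<^sup>2 + b\<^sup>2) * (a'\<^sup>2 + b'\<^sup>2)"
    by (simp add: power2_eq_square algebra_simps)
  then have "(a * a' + b * b')\<^sup>2 + (a * b' - b * a')\<^sup>2 = n\<^sup>2"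
    using n' by (simp add: n_def power2_eq_square)
  then have "C\<^sup>2 + S\<^sup>2 = 1"
    using n0 by (simp add: C_def S_def power_divide flip: add_divide_distrib)
  then obtain t where t: "C = cos t" "S = sin t"
    using sincos_total_2pi by metis
  have "a * C - b * S = a'" "a * S + b * C = b'"
    using n0 by (simp_all add: C_def S_def field_simps)
      (simp_all add: n_def power2_eq_square algebra_simps)
  \<comment> \<open>The translation part is whatever still carries the rotated P to P'.\<close>
  then have "move (x1' - (x1 * C - y1 * S), y1' - (x1 * S + y1 * C), t) P = P' \<and>
        move (x1' - (x1 * C - y1 * S), y1' - (x1 * S + y1 * C), t) Q = Q'"
    by (simp add: eqs t defs algebra_simps)
  then show ?thesis
    by blast
qed

text \<open>The distances to P and Q fix the dot product of X - P with Q - P and, by Lagrange's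
  identity, the square of the cross product. The orientation fixes the remaining sign.\<close>

lemma point_determined:
  assumes "P \<noteq> Q" "dist X P = dist Y P" "dist X Q = dist Y Q"
    and "orient P Q X * orient P Q Y > 0"
  shows "X = Y"
proof -
  obtain p1 p2 q1 q2 x1 x2 y1 y2
    where eqs: "P = (p1, p2)" "Q = (q1, q2)" "X = (x1, x2)" "Y = (y1, y2)"
    by (cases P; cases Q; cases X; cases Y)
  define a b where "a = q1 - p1" "b = q2 - p2"
  define c d c' d' where "c = x1 - p1" "d = x2 - p2" "c' = y1 - p1" "d' = y2 - p2"
  note defs = \<open>a = _\<close> \<open>b = _\<close> this
  have n0: "a\<^sup>2 + b\<^sup>2 \<noteq> 0"
    using assms(1) by (auto simp: defs eqs sum_power2_eq_zero_iff)
  have "(dist X P)\<^sup>2 = (dist Y P)\<^sup>2" "(dist X Q)\<^sup>2 = (dist Y Q)\<^sup>2"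
    by (simp_all add: assms)
  then have norm: "c\<^sup>2 + d\<^sup>2 = c'\<^sup>2 + d'\<^sup>2"
    and "(c - a)\<^sup>2 + (d - b)\<^sup>2 = (c' - a)\<^sup>2 + (d' - b)\<^sup>2"
    by (simp_all add: defs eqs dist_plane_squared)
  then have dot: "a * c + b * d = a * c' + b * d'"
    by (simp add: power2_eq_square algebra_simps)
  have lagrange: "(a * y - b * x)\<^sup>2 = (a\<^sup>2 + b\<^sup>2) * (x\<^sup>2 + y\<^sup>2) - (a * x + b * y)\<^sup>2" for x y
    by (simp add: power2_eq_square algebra_simps)
  have "(a * d - b * c)\<^sup>2 = (a * d' - b * c')\<^sup>2"
    unfolding lagrange norm dot ..
  moreover have "(a * d - b * c) * (a * d' - b * c') > 0"
    using assms(4) by (simp add: eqs defs)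
  ultimately have cross: "a * d - b * c = a * d' - b * c'"
    by (auto simp: power2_eq_iff zero_less_mult_iff)
  \<comment> \<open>Dot and cross product form a linear system for (c, d) with determinant a^2 +
    b^2, solved here by Cramer's rule.\<close>
  have "(a\<^sup>2 + b\<^sup>2) * c = a * (a * c + b * d) - b * (a * d - b * c)"
    "(a\<^sup>2 + b\<^sup>2) * d = b * (a * c + b * d) + a * (a * d - b * c)"
    by (simp_all add: power2_eq_square algebra_simps)
  moreover have "(a\<^sup>2 + b\<^sup>2) * c' = a * (a * c + b * d) - b * (a * d - b * c)"
    "(a\<^sup>2 + b\<^sup>2) * d' = b * (a * c + b * d) + a * (a * d - b * c)"
    unfolding dot cross by (simp_all add: power2_eq_square algebra_simps)
  ultimately have "c = c'" "d = d'"
    using n0 by (metis mult_left_cancel)+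
  then show ?thesis
    by (simp add: eqs defs)
qed

section \<open>Killing tensors and their foci\<close>

text \<open>The prescribed value of u v. With w = v + i u one has w^2 = \<open>sigma\<close> + 2 i
  \<open>half_product\<close>, so \<open>inv_Delta\<close> is |w|^4.\<close>

fun half_product :: "killing \<Rightarrow> real" where
  "half_product (b1, b2, b3, b4, b5, b6) = b6 * b3 + b4 * b5"

lemma inv_Delta_eq: "inv_Delta b = (sigma b)\<^sup>2 + 4 * (half_product b)\<^sup>2"
  by (cases b) (simp add: power2_eq_square algebra_simps)

text \<open>The squares of \<open>u\<close> and \<open>v\<close> in the definition of foci are determined by \<open>v\<^sup>2 - u\<^sup>2\<close> and
  \<open>u v\<close>, since \<open>(u\<^sup>2 + v\<^sup>2)\<^sup>2 = (v\<^sup>2 - u\<^sup>2)\<^sup>2 + 4 (u v)\<^sup>2\<close>; this eliminates the square root.\<close>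

lemma foci_iff_roots:
  "foci (b1, b2, b3, b4, b5, b6) P Q \<longleftrightarrow>
     (\<exists>u v. v\<^sup>2 - u\<^sup>2 = sigma (b1, b2, b3, b4, b5, b6) \<and> u * v = b6 * b3 + b4 * b5 \<and>
        P = (- b5 / b6 + 1 / b6 * u, - b4 / b6 + 1 / b6 * v) \<and>
        Q = (- b5 / b6 - 1 / b6 * u, - b4 / b6 - 1 / b6 * v))"
proof -
  define b where "b = (b1, b2, b3, b4, b5, b6)"
  have "u\<^sup>2 = (sqrt (inv_Delta b) - sigma b) / 2 \<and> v\<^sup>2 = (sqrt (inv_Delta b) + sigma b) / 2 \<longleftrightarrow>
      v\<^sup>2 - u\<^sup>2 = sigma b" if "u * v = b6 * b3 + b4 * b5" for u v
  proof
    assume s: "v\<^sup>2 - u\<^sup>2 = sigma b"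
    have "inv_Delta b = (v\<^sup>2 - u\<^sup>2)\<^sup>2 + 4 * (u * v)\<^sup>2"
      unfolding inv_Delta_eq s that by (simp add: b_def)
    also have "\<dots> = (u\<^sup>2 + v\<^sup>2)\<^sup>2"
      by (simp add: power2_eq_square algebra_simps)
    finally have "sqrt (inv_Delta b) = u\<^sup>2 + v\<^sup>2"
      by simp
    then show "u\<^sup>2 = (sqrt (inv_Delta b) - sigma b) / 2 \<and> v\<^sup>2 = (sqrt (inv_Delta b) + sigma b) / 2"
      by (simp flip: s)
  qed auto
  then show ?thesis
    unfolding foci.simps Let_def unfolding b_def[symmetric] by blast
qed

text \<open>Sums of focus coordinates give b5 and b4, differences give u and v, so the existential
  quantifier disappears and the conditions can be solved for the parameters.\<close>

lemma foci_iff: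
  assumes "b6 \<noteq> 0"
  shows "foci (b1, b2, b3, b4, b5, b6) (x1, y1) (x2, y2) \<longleftrightarrow>
      b5 = - b6 * (x1 + x2) / 2 \<and> b4 = - b6 * (y1 + y2) / 2 \<and>
      sigma (b1, b2, b3, b4, b5, b6) = b6\<^sup>2 * ((y1 - y2)\<^sup>2 - (x1 - x2)\<^sup>2) / 4 \<and>
      b6 * b3 + b4 * b5 = b6\<^sup>2 * (x1 - x2) * (y1 - y2) / 4" (is "?L \<longleftrightarrow> ?R")
proof -
  define s where "s = sigma (b1, b2, b3, b4, b5, b6)"
  have roots: "(x1, y1) = (- b5 / b6 + 1 / b6 * u, - b4 / b6 + 1 / b6 * v) \<and>
        (x2, y2) = (- b5 / b6 - 1 / b6 * u, - b4 / b6 - 1 / b6 * v) \<longleftrightarrow>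
      u = b6 * (x1 - x2) / 2 \<and> v = b6 * (y1 - y2) / 2 \<and>
      b5 = - b6 * (x1 + x2) / 2 \<and> b4 = - b6 * (y1 + y2) / 2" for u v
    using assms by (auto simp: field_simps)
  have "?L \<longleftrightarrow> (\<exists>u v. v\<^sup>2 - u\<^sup>2 = s \<and> u * v = b6 * b3 + b4 * b5 \<and>
      u = b6 * (x1 - x2) / 2 \<and> v = b6 * (y1 - y2) / 2 \<and>
      b5 = - b6 * (x1 + x2) / 2 \<and> b4 = - b6 * (y1 + y2) / 2)"
    unfolding foci_iff_roots s_def[symmetric] roots ..
  also have "\<dots> \<longleftrightarrow> ?R"
  proof -
    have "(b6 * (y1 - y2) / 2)\<^sup>2 - (b6 * (x1 - x2) / 2)\<^sup>2 = b6\<^sup>2 * ((y1 - y2)\<^sup>2 - (x1 - x2)\<^sup>2) / 4"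
      "b6 * (x1 - x2) / 2 * (b6 * (y1 - y2) / 2) = b6\<^sup>2 * (x1 - x2) * (y1 - y2) / 4"
      by (simp_all add: power2_eq_square field_simps)
    then show ?thesis
      unfolding s_def[symmetric] by metis
  qed
  finally show ?thesis .
qed

section \<open>Tensors rebuilt from their foci\<close>

text \<open>Inverse of taking foci: b4 and b5 come from the midpoint, b3 from u v, and b1, b2 from
  the sum and difference of the equations for trace and \<open>sigma\<close>.\<close>

fun killing_of :: "real \<Rightarrow> real \<Rightarrow> plane \<Rightarrow> plane \<Rightarrow> killing" where
  "killing_of m t (x1, y1) (x2, y2) =
     (let b4 = - m * (y1 + y2) / 2; b5 = - m * (x1 + x2) / 2;
          s = m\<^sup>2 * ((y1 - y2)\<^sup>2 - (x1 - x2)\<^sup>2) / 4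
      in ((t + 2 * b4\<^sup>2 - s) / (2 * m), (t + 2 * b5\<^sup>2 + s) / (2 * m),
          (m\<^sup>2 * (x1 - x2) * (y1 - y2) / 4 - b4 * b5) / m, b4, b5, m))"

lemma eq_killing_of_iff:
  assumes "m \<noteq> 0"
  shows "b = killing_of m t P Q \<longleftrightarrow> foci b P Q \<and> inv_lead b = m \<and> inv_trace b = t"
proof -
  obtain b1 b2 b3 b4 b5 b6 where b: "b = (b1, b2, b3, b4, b5, b6)"
    by (cases b) auto
  obtain x1 y1 x2 y2 where PQ: "P = (x1, y1)" "Q = (x2, y2)"
    by (cases P; cases Q)
  define s where "s = m\<^sup>2 * ((y1 - y2)\<^sup>2 - (x1 - x2)\<^sup>2) / 4"
  define C where "C = m\<^sup>2 * (x1 - x2) * (y1 - y2) / 4"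
  have b3: "b3 = (C - b4 * b5) / m \<longleftrightarrow> m * b3 + b4 * b5 = C"
    using assms by (auto simp: field_simps)
  have "b1 = (t + 2 * b4\<^sup>2 - s) / (2 * m) \<and> b2 = (t + 2 * b5\<^sup>2 + s) / (2 * m) \<longleftrightarrow>
      2 * (m * b1) = t + 2 * b4\<^sup>2 - s \<and> 2 * (m * b2) = t + 2 * b5\<^sup>2 + s"
    using assms by (auto simp: field_simps)
  also have "\<dots> \<longleftrightarrow> sigma (b1, b2, b3, b4, b5, m) = s \<and> m * (b1 + b2) - b4\<^sup>2 - b5\<^sup>2 = t"
    by (auto simp: algebra_simps)
  finally have b12: "b1 = (t + 2 * b4\<^sup>2 - s) / (2 * m) \<and> b2 = (t + 2 * b5\<^sup>2 + s) / (2 * m) \<longleftrightarrow>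
      sigma (b1, b2, b3, b4, b5, m) = s \<and> m * (b1 + b2) - b4\<^sup>2 - b5\<^sup>2 = t" .
  have "b = killing_of m t P Q \<longleftrightarrow> b6 = m \<and> b4 = - m * (y1 + y2) / 2 \<and> b5 = - m * (x1 + x2) / 2 \<and>
      b3 = (C - b4 * b5) / m \<and>
      (b1 = (t + 2 * b4\<^sup>2 - s) / (2 * m) \<and> b2 = (t + 2 * b5\<^sup>2 + s) / (2 * m))"
    unfolding b PQ killing_of.simps Let_def s_def C_def by blast
  also have "\<dots> \<longleftrightarrow> b6 = m \<and> foci (b1, b2, b3, b4, b5, m) P Q \<and> m * (b1 + b2) - b4\<^sup>2 - b5\<^sup>2 = t"
    unfolding b3 b12 PQ foci_iff[OF assms] unfolding s_def C_def by blast
  also have "\<dots> \<longleftrightarrow> foci b P Q \<and> inv_lead b = m \<and> inv_trace b = t"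
    by (auto simp: b simp del: foci.simps)
  finally show ?thesis .
qed

text \<open>Since u and v are m/2 times the coordinate differences of the foci, sqrt Delta = u^2 +
  v^2 is m^2/4 times their squared distance. This supplies the sides F1 F2 and F3 F4, which are not
  among the listed distances.\<close>

lemma inv_Delta_foci:
  assumes "foci b P Q" "inv_lead b \<noteq> 0"
  shows "inv_Delta b = ((inv_lead b)\<^sup>2 * (dist P Q)\<^sup>2 / 4)\<^sup>2"
proof -
  obtain b1 b2 b3 b4 b5 b6 where b: "b = (b1, b2, b3, b4, b5, b6)"
    by (cases b) auto
  obtain x1 y1 x2 y2 where PQ: "P = (x1, y1)" "Q = (x2, y2)"
    by (cases P; cases Q)
  have s: "sigma b = b6\<^sup>2 * ((y1 - y2)\<^sup>2 - (x1 - x2)\<^sup>2) / 4"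
    and C: "half_product b = b6\<^sup>2 * (x1 - x2) * (y1 - y2) / 4"
    using assms foci_iff[of b6 b1 b2 b3 b4 b5 x1 y1 x2 y2]
    by (auto simp: b PQ simp del: foci.simps sigma.simps)
  have "((Y\<^sup>2 - X\<^sup>2) * k / 4)\<^sup>2 + 4 * (k * X * Y / 4)\<^sup>2 = (k * (X\<^sup>2 + Y\<^sup>2) / 4)\<^sup>2" for X Y k :: real
    by (simp add: power2_eq_square field_simps)
  from this[of "y1 - y2" "x1 - x2" "b6\<^sup>2"] show ?thesis
    unfolding inv_Delta_eq s C PQ dist_plane_squared by (simp add: b mult.commute)
qed

lemma nondegenerate_iff:
  assumes "foci b P Q"
  shows "nondegenerate b \<longleftrightarrow> inv_lead b \<noteq> 0 \<and> P \<noteq> Q"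
  using inv_Delta_foci[OF assms] by (auto simp: nondegenerate_def k_squared_def)

section \<open>Equivariance under SE(2)\<close>

lemma inv_lead_act: "inv_lead (act p b) = inv_lead b"
  by (cases p; cases b) simp

lemma inv_trace_act: "inv_trace (act p b) = inv_trace b"
proof -
  obtain b1 b2 b3 b4 b5 b6 p1 p2 p3
    where eqs: "b = (b1, b2, b3, b4, b5, b6)" "p = (p1, p2, p3)"
    by (cases b; cases p) auto
  have "inv_trace (act p b) = ((cos p3)\<^sup>2 + (sin p3)\<^sup>2) * inv_trace b"
    unfolding eqs act.simps inv_trace.simps by (simp only: power2_eq_square algebra_simps)
  then show ?thesis
    by simp
qed

text \<open>The vector (u, v) is rotated by p3, while (\<open>sigma\<close>, 2
  \<open>half_product\<close>), made of its quadratic expressions, rotates by the double angle;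
  translations change neither.\<close>

lemma foci_act:
  assumes "foci b P Q" "inv_lead b \<noteq> 0"
  shows "foci (act p b) (move p P) (move p Q)"
proof -
  obtain b1 b2 b3 b4 b5 b6 p1 p2 p3
    where eqs: "b = (b1, b2, b3, b4, b5, b6)" "p = (p1, p2, p3)"
    by (cases b; cases p) auto
  define c s where "c = cos p3" and "s = sin p3"
  have b6: "b6 \<noteq> 0"
    using assms(2) by (simp add: eqs)
  obtain u v where uv: "v\<^sup>2 - u\<^sup>2 = sigma b" "u * v = half_product b"
    and P: "P = (- b5 / b6 + 1 / b6 * u, - b4 / b6 + 1 / b6 * v)"
    and Q: "Q = (- b5 / b6 - 1 / b6 * u, - b4 / b6 - 1 / b6 * v)"
    using assms(1) unfolding eqs foci_iff_roots half_product.simps by blast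
  have "sigma (act p b) = (c\<^sup>2 - s\<^sup>2) * sigma b + 4 * c * s * half_product b"
    unfolding eqs act.simps sigma.simps half_product.simps c_def[symmetric] s_def[symmetric]
    by (simp add: power2_eq_square algebra_simps)
  also have "\<dots> = (u * s + v * c)\<^sup>2 - (u * c - v * s)\<^sup>2"
    unfolding uv[symmetric] by (simp add: power2_eq_square algebra_simps)
  finally have 1: "(u * s + v * c)\<^sup>2 - (u * c - v * s)\<^sup>2 = sigma (act p b)" ..
  have "half_product (act p b) = (c\<^sup>2 - s\<^sup>2) * half_product b - c * s * sigma b"
    unfolding eqs act.simps sigma.simps half_product.simps c_def[symmetric] s_def[symmetric]
    by (simp add: power2_eq_square algebra_simps)
  also have "\<dots> = (u * c - v * s) * (u * s + v * c)"
    unfolding uv[symmetric] by (simp add: power2_eq_square algebra_simps)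
  finally have 2: "(u * c - v * s) * (u * s + v * c) = half_product (act p b)" ..
  show ?thesis
    using 1 2 b6
    unfolding eqs act.simps foci_iff_roots half_product.simps c_def[symmetric] s_def[symmetric] P Q
      move.simps
    by (intro exI[of _ "u * c - v * s"] exI[of _ "u * s + v * c"]) (auto simp: field_simps)
qed

text \<open>Follows from the invariance of the focal distance, without expanding the transformed
  parameters.\<close>

lemma inv_Delta_act: "inv_lead b \<noteq> 0 \<Longrightarrow> inv_Delta (act p b) = inv_Delta b"
  by (metis foci_exist foci_act inv_Delta_foci inv_lead_act dist_move)

lemma nondegenerate_act: "nondegenerate b \<Longrightarrow> nondegenerate (act p b)"
  by (auto simp: nondegenerate_def k_squared_def inv_lead_act inv_Delta_act)

lemma tendsto_killing_of:
  assumes "(f \<longlongrightarrow> P) F" "(g \<longlongrightarrow> Q) F" "m \<noteq> 0"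
  shows "((\<lambda>x. killing_of m t (f x) (g x)) \<longlongrightarrow> killing_of m t P Q) F"
proof -
  have *: "killing_of m t R S = (let b4 = - m * (snd R + snd S) / 2; b5 = - m * (fst R + fst S) / 2;
          s = m\<^sup>2 * ((snd R - snd S)\<^sup>2 - (fst R - fst S)\<^sup>2) / 4
      in ((t + 2 * b4\<^sup>2 - s) / (2 * m), (t + 2 * b5\<^sup>2 + s) / (2 * m),
          (m\<^sup>2 * (fst R - fst S) * (snd R - snd S) / 4 - b4 * b5) / m, b4, b5, m))" for R S
    by (cases R; cases S) simp
  show ?thesis
    unfolding * Let_def using assms by (intro tendsto_intros) auto
qed

section \<open>Configurations\<close>

lemma configs_iff:
  "(a, b, F1, F2, F3, F4) \<in> configs \<longleftrightarrow>
     nondegenerate a \<and> nondegenerate b \<and> foci b F1 F2 \<and> foci a F3 F4"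
  by (simp add: configs_def)

lemma generic_configs_iff:
  "(a, b, F1, F2, F3, F4) \<in> generic_configs \<longleftrightarrow>
     (a, b, F1, F2, F3, F4) \<in> configs \<and> orient F1 F2 F3 \<noteq> 0 \<and> orient F2 F3 F4 \<noteq> 0"
  by (simp add: generic_configs_def collinear_iff_orient)

lemma act_config_configs:
  assumes "c \<in> configs"
  shows "act_config p c \<in> configs"
proof -
  obtain a b F1 F2 F3 F4 where "c = (a, b, F1, F2, F3, F4)"
    by (rule prod_cases6)
  then show ?thesis
    using assms nondegenerate_act foci_act by (simp add: configs_iff nondegenerate_def)
qed

lemma fundamental_invariants_act:
  assumes "c \<in> configs"
  shows "fundamental_invariants (act_config p c) = fundamental_invariants c"
proof -
  obtain a b F1 F2 F3 F4 where "c = (a, b, F1, F2, F3, F4)"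
    by (rule prod_cases6)
  then show ?thesis
    using assms
    by (simp add: configs_iff nondegenerate_def inv_lead_act inv_trace_act inv_Delta_act dist_move)
qed

section \<open>Density of generic configurations\<close>

lemma eventually_monic_quadratic_nonzero:
  "eventually (\<lambda>t. t\<^sup>2 + k * t + l \<noteq> 0) (at (0 :: real))"
proof -
  have "finite {t. poly [:l, k, 1:] t = 0}"
    by (rule poly_roots_finite) simp
  then have "eventually (\<lambda>t. t \<notin> {t. poly [:l, k, 1:] t = 0}) (at 0)"
    using islimpt_finite islimpt_iff_eventually by blast
  then show ?thesis
    by (simp add: power2_eq_square algebra_simps)
qed

text \<open>The foci are perturbed and the tensors rebuilt from them with unchanged leading and
  trace invariants, so the labels of the foci are kept.\<close>

lemma configs_subset_closure: "configs \<subseteq> closure generic_configs"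
proof
  fix c assume c: "c \<in> configs"
  obtain a b F1 F2 F3 F4 where ceq: "c = (a, b, F1, F2, F3, F4)"
    by (cases c)
  obtain x1 y1 x2 y2 x3 y3 x4 y4
    where F: "F1 = (x1, y1)" "F2 = (x2, y2)" "F3 = (x3, y3)" "F4 = (x4, y4)"
    by (cases F1; cases F2; cases F3; cases F4)
  define m n where "m = inv_lead a" and "n = inv_lead b"
  have foc: "foci b F1 F2" "foci a F3 F4" and mn: "m \<noteq> 0" "n \<noteq> 0"
    using c by (auto simp: ceq configs_iff nondegenerate_def m_def n_def)
  have a: "a = killing_of m (inv_trace a) F3 F4" and b: "b = killing_of n (inv_trace b) F1 F2"
    using foc mn by (simp_all add: eq_killing_of_iff m_def n_def)
  \<comment> \<open>The directions are chosen so that, up to sign, both orientations become monic quadratics in \<open>t\<close>.\<close>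
  define G1 G2 G3 G4 where "G1 t = (x1 + t, y1)" and "G2 t = (x2, y2)" and "G3 t = (x3, y3 - t)"
    and "G4 t = (x4 - t, y4)" for t
  define d where "d t = (killing_of m (inv_trace a) (G3 t) (G4 t),
    killing_of n (inv_trace b) (G1 t) (G2 t), G1 t, G2 t, G3 t, G4 t)" for t
  have G: "(G1 \<longlongrightarrow> F1) (at 0)" "(G2 \<longlongrightarrow> F2) (at 0)" "(G3 \<longlongrightarrow> F3) (at 0)" "(G4 \<longlongrightarrow> F4) (at 0)"
    unfolding F G1_def[abs_def] G2_def[abs_def] G3_def[abs_def] G4_def[abs_def]
    by (auto intro!: tendsto_eq_intros)
  have "(d \<longlongrightarrow> (killing_of m (inv_trace a) F3 F4, killing_of n (inv_trace b) F1 F2, F1, F2, F3, F4)) (at 0)"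
    unfolding d_def[abs_def] by (intro tendsto_Pair tendsto_killing_of G mn)
  then have lim: "(d \<longlongrightarrow> c) (at 0)"
    using a b by (simp add: ceq)
  have "\<exists>k l. \<forall>t. orient (G1 t) (G2 t) (G3 t) = t\<^sup>2 + k * t + l"
    by (rule exI[of _ "(x1 - x2) + (y2 - y3)"], rule exI[of _ "orient F1 F2 F3"])
      (simp add: G1_def G2_def G3_def F power2_eq_square algebra_simps)
  then have 1: "eventually (\<lambda>t. orient (G1 t) (G2 t) (G3 t) \<noteq> 0) (at 0)"
    using eventually_monic_quadratic_nonzero by auto
  have "\<exists>k l. \<forall>t. - orient (G2 t) (G3 t) (G4 t) = t\<^sup>2 + k * t + l"
    by (rule exI[of _ "(x2 - x4) + (y2 - y3)"], rule exI[of _ "- orient F2 F3 F4"])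
      (simp add: G4_def G2_def G3_def F power2_eq_square algebra_simps)
  then obtain k l where "- orient (G2 t) (G3 t) (G4 t) = t\<^sup>2 + k * t + l" for t
    by blast
  then have "eventually (\<lambda>t. - orient (G2 t) (G3 t) (G4 t) \<noteq> 0) (at 0)"
    by (simp only: eventually_monic_quadratic_nonzero)
  then have "eventually (\<lambda>t. orient (G2 t) (G3 t) (G4 t) \<noteq> 0) (at 0)"
    by simp
  with 1 have "eventually (\<lambda>t. d t \<in> generic_configs) (at 0)"
  proof eventually_elim
    case (elim t)
    \<comment> \<open>Non-zero orientation keeps the two foci of each tensor apart, which makes the
      rebuilt tensors non-degenerate.\<close>
    then have "G1 t \<noteq> G2 t" "G3 t \<noteq> G4 t"
      by (auto simp: orient_fst_snd)
    moreover have "foci (killing_of m (inv_trace a) (G3 t) (G4 t)) (G3 t) (G4 t)"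
      "inv_lead (killing_of m (inv_trace a) (G3 t) (G4 t)) = m"
      "foci (killing_of n (inv_trace b) (G1 t) (G2 t)) (G1 t) (G2 t)"
      "inv_lead (killing_of n (inv_trace b) (G1 t) (G2 t)) = n"
      using eq_killing_of_iff mn by blast+
    ultimately show ?case
      using elim mn by (simp add: d_def generic_configs_iff configs_iff nondegenerate_iff)
  qed
  then show "c \<in> closure generic_configs"
    by (intro Lim_in_closed_set[OF closed_closure _ trivial_limit_at lim])
      (auto elim: eventually_mono intro: subsetD[OF closure_subset])
qed

section \<open>Separation of orbits and the local function\<close>

text \<open>The side F2 F3 common to both triangles is moved first; F1 and F4 then have no choice
  left.\<close>

lemma same_orbit:
  assumes "(a, b, F1, F2, F3, F4) \<in> configs" "(a', b', F1', F2', F3', F4') \<in> configs"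
    and inv: "fundamental_invariants (a, b, F1, F2, F3, F4) =
      fundamental_invariants (a', b', F1', F2', F3', F4')"
    and orient: "orient F1 F2 F3 * orient F1' F2' F3' > 0" "orient F2 F3 F4 * orient F2' F3' F4' > 0"
  shows "\<exists>p. act_config p (a, b, F1, F2, F3, F4) = (a', b', F1', F2', F3', F4')"
proof -
  have lead: "inv_lead a \<noteq> 0" "inv_lead b \<noteq> 0" "inv_lead a' = inv_lead a" "inv_lead b' = inv_lead b"
    and trace: "inv_trace a' = inv_trace a" "inv_trace b' = inv_trace b"
    and foci: "foci b F1 F2" "foci a F3 F4" "foci b' F1' F2'" "foci a' F3' F4'"
    and Delta: "inv_Delta a = inv_Delta a'" "inv_Delta b = inv_Delta b'"
    and dist: "dist F2 F3 = dist F2' F3'" "dist F1 F3 = dist F1' F3'" "dist F2 F4 = dist F2' F4'"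
    using assms(1,2) inv by (auto simp: configs_iff nondegenerate_def power2_eq_iff_nonneg)
  have dist12: "dist F1 F2 = dist F1' F2'"
    using Delta(2) lead(2) inv_Delta_foci[OF foci(1)] inv_Delta_foci[OF foci(3)]
    by (simp add: lead power2_eq_iff_nonneg)
  have dist34: "dist F3 F4 = dist F3' F4'"
    using Delta(1) lead(1) inv_Delta_foci[OF foci(2)] inv_Delta_foci[OF foci(4)]
    by (simp add: lead power2_eq_iff_nonneg)
  have ne: "F2 \<noteq> F3" "F2' \<noteq> F3'"
    using orient by (auto simp: orient_fst_snd)
  obtain p where p: "move p F2 = F2'" "move p F3 = F3'"
    using exists_move[OF ne(1) dist(1)] by blast
  have cyc: "orient Q R P = orient P Q R" for P Q R
    by (simp add: orient_fst_snd algebra_simps)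
  have "orient F2' F3' (move p F1) = orient F1 F2 F3" "orient F2' F3' (move p F4) = orient F2 F3 F4"
    unfolding p[symmetric] orient_move by (simp_all add: cyc)
  then have "orient F2' F3' (move p F1) * orient F2' F3' F1' > 0"
    "orient F2' F3' (move p F4) * orient F2' F3' F4' > 0"
    using orient by (simp_all add: cyc[of F2' F3' F1'])
  moreover have "dist (move p F1) F2' = dist F1' F2'" "dist (move p F1) F3' = dist F1' F3'"
    "dist (move p F4) F2' = dist F4' F2'" "dist (move p F4) F3' = dist F4' F3'"
    using dist dist12 dist34 by (metis dist_move dist_commute p)+
  ultimately have F14: "move p F1 = F1'" "move p F4 = F4'"
    using point_determined[OF ne(2)] by blast+
  have "foci (act p b) F1' F2'" "foci (act p a) F3' F4'"
    using foci_act[OF foci(1), of p] foci_act[OF foci(2), of p] lead p F14 by simp_all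
  \<comment> \<open>Equal foci, leading coefficient and trace force equal tensors.\<close>
  then have "act p b = b'" "act p a = a'"
    using foci lead trace by (metis eq_killing_of_iff inv_lead_act inv_trace_act)+
  then show ?thesis
    using p F14 by (intro exI[of _ p]) simp
qed

text \<open>A mirror image has the same nine values but opposite orientations, so \<Phi> is sought
  on an invariant neighbourhood where both signs are constant.\<close>

theorem theorem4p1:
  fixes I :: "killing \<times> killing \<Rightarrow> real"
  assumes "joint_invariant I"
  shows "(\<forall>p. \<forall>c\<in>configs. act_config p c \<in> configs \<and>
            fundamental_invariants (act_config p c) = fundamental_invariants c)
       \<and> configs \<subseteq> closure generic_configs
       \<and> (\<forall>c\<in>generic_configs. \<exists>U \<Phi>.
            openin (top_of_set configs) U \<and> c \<in> U \<and> (\<forall>p. act_config p ` U \<subseteq> U) \<and>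
            (\<forall>(a, b, F)\<in>U. I (a, b) = \<Phi> (fundamental_invariants (a, b, F))))"
proof (intro conjI allI ballI)
  fix c assume c: "c \<in> generic_configs"
  define o1 :: "config \<Rightarrow> real" where "o1 = (\<lambda>(a, b, F1, F2, F3, F4). orient F1 F2 F3)"
  define o2 :: "config \<Rightarrow> real" where "o2 = (\<lambda>(a, b, F1, F2, F3, F4). orient F2 F3 F4)"
  \<comment> \<open>Both triangles are oriented as in c, expressed by positive products.\<close>
  define U where "U = configs \<inter> {x. 0 < o1 x * o1 c \<and> 0 < o2 x * o2 c}"
  have cont: "continuous_on UNIV o1" "continuous_on UNIV o2"
    unfolding o1_def o2_def case_prod_beta orient_fst_snd by (intro continuous_intros)+
  have "openin (top_of_set configs) U"
    unfolding U_def using cont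
    by (intro openin_open_Int open_Collect_conj open_Collect_less continuous_intros) auto
  moreover have "c \<in> U"
    using c by (cases c) (auto simp: U_def generic_configs_iff o1_def o2_def zero_less_mult_iff)
  moreover have "act_config p ` U \<subseteq> U" for p
  proof -
    have "o1 (act_config p x) = o1 x" "o2 (act_config p x) = o2 x" for x
      by (cases x; simp add: o1_def o2_def orient_move)+
    then show ?thesis
      by (auto simp: U_def act_config_configs simp del: act_config.simps)
  qed
  moreover have same_value: "I (fst x, fst (snd x)) = I (fst y, fst (snd y))"
    if xy: "x \<in> U" "y \<in> U" "fundamental_invariants x = fundamental_invariants y" for x y
  proof -
    obtain a b F1 F2 F3 F4 where x: "x = (a, b, F1, F2, F3, F4)"
      by (rule prod_cases6)
    obtain a' b' F1' F2' F3' F4' where y: "y = (a', b', F1', F2', F3', F4')"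
      by (rule prod_cases6)
    have "o1 x * o1 y > 0" "o2 x * o2 y > 0"
      using xy by (auto simp: U_def zero_less_mult_iff)
    then have "orient F1 F2 F3 * orient F1' F2' F3' > 0" "orient F2 F3 F4 * orient F2' F3' F4' > 0"
      by (simp_all add: o1_def o2_def x y)
    moreover have configs: "(a, b, F1, F2, F3, F4) \<in> configs" "(a', b', F1', F2', F3', F4') \<in> configs"
      using xy by (simp_all add: U_def x y)
    ultimately obtain p where "act_config p (a, b, F1, F2, F3, F4) = (a', b', F1', F2', F3', F4')"
      using same_orbit xy(3) unfolding x y by blast
    then have "a' = act p a" "b' = act p b"
      by simp_all
    moreover have "I (act p a, act p b) = I (a, b)"
      using assms configs unfolding joint_invariant_def configs_iff by blast
    ultimately show ?thesis
      by (simp add: x y)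
  qed
  \<comment> \<open>\<Phi> evaluates I at a chosen member of U with the given invariants;
    \<open>same_value\<close> makes the choice immaterial. Values not attained on U get an arbitrary
    result.\<close>
  have "\<exists>\<Phi>. \<forall>x\<in>U. I (fst x, fst (snd x)) = \<Phi> (fundamental_invariants x)"
  proof (intro exI ballI)
    fix x assume "x \<in> U"
    define y where "y = (SOME y. y \<in> U \<and> fundamental_invariants y = fundamental_invariants x)"
    have "y \<in> U \<and> fundamental_invariants y = fundamental_invariants x"
      unfolding y_def by (rule someI[of _ x]) (simp add: \<open>x \<in> U\<close>)
    then have "I (fst x, fst (snd x)) = I (fst y, fst (snd y))"
      using \<open>x \<in> U\<close> by (intro same_value) auto
    then show "I (fst x, fst (snd x)) =
        (\<lambda>v. let y = (SOME y. y \<in> U \<and> fundamental_invariants y = v) in I (fst y, fst (snd y)))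
          (fundamental_invariants x)"
      by (simp add: y_def Let_def)
  qed
  then have "\<exists>\<Phi>. \<forall>(a, b, F)\<in>U. I (a, b) = \<Phi> (fundamental_invariants (a, b, F))"
    by (simp add: case_prod_beta)
  ultimately show "\<exists>U \<Phi>. openin (top_of_set configs) U \<and> c \<in> U \<and> (\<forall>p. act_config p ` U \<subseteq> U) \<and>
      (\<forall>(a, b, F)\<in>U. I (a, b) = \<Phi> (fundamental_invariants (a, b, F)))"
    by blast
qed (use act_config_configs fundamental_invariants_act configs_subset_closure in auto)

end
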